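(* Consider the random linear coding policy with blocklength $K\ge1$ in the two-source, two-destination random access multicast system with transmission probabilities $(p_1,p_2)\in[0,1]^2$. Let $\widetilde\mu_{1b}=K/E[\widetilde T_1]$ be the service rate (in packets per slot) of source 1 when source 2 is backlogged, and let $N_1^{(m)}$ be the number of coded packets from source 1 that must be received at destination $m$ in order to decode ($E[N_1^{(m)}]$ does not depend on $m$). Then $$\widetilde\mu_{1b}\le\frac{K}{E[N_1^{(m)}]}\min_{m=1,2}\left[p_1(1-p_2)q_{1|1}^{(m)}+p_1p_2\,q_{1|1,2}^{(m)}\right]\le\min_{m=1,2}\left[p_1(1-p_2)q_{1|1}^{(m)}+p_1p_2\,q_{1|1,2}^{(m)}\right].$$ That is, the backlogged service rate is bounded by the bound on the Shannon achievable rate $R_1$ of the random access system.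
   Context: System: time is slotted and two sources $n=1,2$ multicast packets to two destinations $m=1,2$. In each slot a backlogged source $n$ transmits with probability $p_n$, independently of the other source and across slots. $q_{n|n}^{(m)}$ is the probability that the packet from source $n$ is received at destination $m$ given that only $n$ transmits. $q_{n|1,2}^{(m)}$ is the same probability given that both sources transmit. It is assumed that $q_{n|n}^{(m)}>q_{n|1,2}^{(m)}$, and that channels of different source-destination pairs are independent. Feedback is instantaneous and error-free. Random linear coding policy: let $s_1,\dots,s_K$ be the $K$ binary packets at the front of the queue. In each slot the source generates a fresh coded packet $\sum_{i=1}^K a_is_i$ (modulo-2 sum), where the coefficients $a_i$ are independent with $\Pr(a_i=1)=\Pr(a_i=0)=1/2$, independently across slots and sources. It transmits this packet with probability $p_n$, and the coefficients are included in the packet header. A destination can decode the $K$ packets as soon as the coefficient vectors of the coded packets it has received have rank $K$ over $\mathbb F_2$. When both destinations can decode, the source removes the $K$ packets from its queue and starts on the next $K$. Service time: $N_1^{(m)}$ is the number of coded packets received from source 1 at destination $m$ up to the moment destination $m$ can decode. It has the same distribution for $m=1,2$, namely $\Pr\{N_1^{(m)}\le j\}$ is the probability that a uniformly random $K\times j$ binary matrix has rank $K$. $N_1^{(1)}$ and $N_1^{(2)}$ may be dependent. The service time from source 1 to destination $m$ is $\widetilde T_1^{(m)}=g_{1,1}^{(m)}+\dots+g_{1,N_1^{(m)}}^{(m)}$. When source 2 is backlogged (so it transmits in every slot with probability $p_2$), the $g_{1,i}^{(m)}$ are i.i.d. geometric with parameter $p_1(1-p_2)q_{1|1}^{(m)}+p_1p_2q_{1|1,2}^{(m)}$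 and independent of $N_1^{(m)}$. The total service time is $\widetilde T_1=\max_{m=1,2}\widetilde T_1^{(m)}$. If a geometric parameter is $0$, the corresponding time is $+\infty$, and $K/\infty=0$. *)

theory Defs
  imports
    "HOL-Probability.Probability"
    "HOL-Library.Z2"
    "Jordan_Normal_Form.DL_Rank"
begin

datatype source = S1 | S2
datatype dest = D1 | D2

text \<open>
  The outcome of one slot: which sources transmit, the coefficient vector (header) of the coded
  packet generated by each source, and which source-destination pairs see a reception.
  The payload (the modulo-2 sum of the queued packets) plays no role: whether a destination can
  decode depends on the headers only.
\<close>

datatype slot = Slot (tx: "source \<Rightarrow> bool") (header: "source \<Rightarrow> bit vec") (rx: "source \<times> dest \<Rightarrow> bool")

definition header_pmf :: "nat \<Rightarrow> bit vec pmf" where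
  "header_pmf K = map_pmf vec_of_list (replicate_pmf K (pmf_of_set {0, 1}))"

text \<open>
  \<open>q_alone n m\<close> is the probability that the packet of source \<open>n\<close> is received at \<open>m\<close> given that only
  \<open>n\<close> transmits; \<open>q_both n m\<close> is the same probability given that both sources transmit.
\<close>

definition reception_prob ::
  "(source \<Rightarrow> dest \<Rightarrow> real) \<Rightarrow> (source \<Rightarrow> dest \<Rightarrow> real) \<Rightarrow> (source \<Rightarrow> bool) \<Rightarrow> source \<times> dest \<Rightarrow> real"
where
  "reception_prob q_alone q_both x = (\<lambda>(n, m).
     if \<not> x n then 0 else if x S1 \<and> x S2 then q_both n m else q_alone n m)"

text \<open>
  Both sources are backlogged, so each of them transmits with its own probability in every slot.
  \<open>Pi_pmf\<close> is the product distribution (its second argument is a dummy value outside the index set).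
\<close>

definition slot_pmf ::
  "nat \<Rightarrow> (source \<Rightarrow> real) \<Rightarrow> (source \<Rightarrow> dest \<Rightarrow> real) \<Rightarrow> (source \<Rightarrow> dest \<Rightarrow> real) \<Rightarrow> slot pmf"
where
  "slot_pmf K p q_alone q_both = do {
     x \<leftarrow> Pi_pmf {S1, S2} False (\<lambda>n. bernoulli_pmf (p n));
     a \<leftarrow> Pi_pmf {S1, S2} (0\<^sub>v K) (\<lambda>_. header_pmf K);
     r \<leftarrow> Pi_pmf ({S1, S2} \<times> {D1, D2}) False
            (\<lambda>c. bernoulli_pmf (reception_prob q_alone q_both x c));
     return_pmf (Slot x a r)
   }"

text \<open>
  The slots are independent; slot \<open>0\<close> is the first slot in which the current block of \<open>K\<close> packets is
  served.
\<close>

definition slots ::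
  "nat \<Rightarrow> (source \<Rightarrow> real) \<Rightarrow> (source \<Rightarrow> dest \<Rightarrow> real) \<Rightarrow> (source \<Rightarrow> dest \<Rightarrow> real) \<Rightarrow> (nat \<Rightarrow> slot) measure"
where
  "slots K p q_alone q_both = (\<Pi>\<^sub>M t\<in>UNIV. measure_pmf (slot_pmf K p q_alone q_both))"

text \<open>Headers of the packets from \<open>n\<close> received at \<open>m\<close> during the first \<open>t\<close> slots, in order.\<close>

definition received :: "source \<Rightarrow> dest \<Rightarrow> (nat \<Rightarrow> slot) \<Rightarrow> nat \<Rightarrow> bit vec list" where
  "received n m \<omega> t = map (\<lambda>s. header (\<omega> s) n) (filter (\<lambda>s. rx (\<omega> s) (n, m)) [0..<t])"

definition decodable :: "nat \<Rightarrow> source \<Rightarrow> dest \<Rightarrow> (nat \<Rightarrow> slot) \<Rightarrow> nat \<Rightarrow> bool" where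
  "decodable K n m \<omega> t \<longleftrightarrow> vec_space.rank K (mat_of_cols K (received n m \<omega> t)) = K"

text \<open>
  Number of coded packets received until decoding. It is infinite if \<open>m\<close> never decodes, which has
  positive probability only if \<open>m\<close> almost surely never receives anything from \<open>n\<close>.
\<close>

definition packets_needed :: "nat \<Rightarrow> source \<Rightarrow> dest \<Rightarrow> (nat \<Rightarrow> slot) \<Rightarrow> enat" where
  "packets_needed K n m \<omega> =
     (if \<exists>t. decodable K n m \<omega> t
      then enat (length (received n m \<omega> (LEAST t. decodable K n m \<omega> t))) else \<infinity>)"

text \<open>
  Number of slots elapsed when the \<open>i\<close>-th packet has been received (\<open>0\<close> for \<open>i = 0\<close>, and infinite if
  there is no \<open>i\<close>-th reception).
\<close>

definition reception_time :: "source \<Rightarrow> dest \<Rightarrow> (nat \<Rightarrow> slot) \<Rightarrow> nat \<Rightarrow> enat" where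
  "reception_time n m \<omega> i =
     (if \<exists>t. i \<le> length (received n m \<omega> t)
      then enat (LEAST t. i \<le> length (received n m \<omega> t)) else \<infinity>)"

text \<open>The time \<open>g\<close> between receptions \<open>i - 1\<close> and \<open>i\<close>; note that \<open>\<infinity> - \<infinity> = \<infinity>\<close> in \<^typ>\<open>enat\<close>.\<close>

definition gap :: "source \<Rightarrow> dest \<Rightarrow> (nat \<Rightarrow> slot) \<Rightarrow> nat \<Rightarrow> enat" where
  "gap n m \<omega> i = reception_time n m \<omega> i - reception_time n m \<omega> (i - 1)"

definition service_time_at :: "nat \<Rightarrow> source \<Rightarrow> dest \<Rightarrow> (nat \<Rightarrow> slot) \<Rightarrow> enat" where
  "service_time_at K n m \<omega> =
     (case packets_needed K n m \<omega> of enat N \<Rightarrow> (\<Sum>i = 1..N. gap n m \<omega> i) | \<infinity> \<Rightarrow> \<infinity>)"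

definition service_time :: "nat \<Rightarrow> source \<Rightarrow> (nat \<Rightarrow> slot) \<Rightarrow> enat" where
  "service_time K n \<omega> = (MAX m\<in>{D1, D2}. service_time_at K n m \<omega>)"

text \<open>
  Expectations and rates are taken in \<^typ>\<open>ennreal\<close>, where \<open>x / \<infinity> = 0\<close>.
\<close>

definition expected_packets_needed ::
  "nat \<Rightarrow> (source \<Rightarrow> real) \<Rightarrow> (source \<Rightarrow> dest \<Rightarrow> real) \<Rightarrow> (source \<Rightarrow> dest \<Rightarrow> real)
     \<Rightarrow> source \<Rightarrow> dest \<Rightarrow> ennreal"
where
  "expected_packets_needed K p q_alone q_both n m =
     (\<integral>\<^sup>+ \<omega>. ennreal_of_enat (packets_needed K n m \<omega>) \<partial>slots K p q_alone q_both)"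

definition backlogged_service_rate ::
  "nat \<Rightarrow> (source \<Rightarrow> real) \<Rightarrow> (source \<Rightarrow> dest \<Rightarrow> real) \<Rightarrow> (source \<Rightarrow> dest \<Rightarrow> real) \<Rightarrow> source \<Rightarrow> ennreal"
where
  "backlogged_service_rate K p q_alone q_both n =
     of_nat K / (\<integral>\<^sup>+ \<omega>. ennreal_of_enat (service_time K n \<omega>) \<partial>slots K p q_alone q_both)"

end

(*
  As long as a destination cannot decode, whether it receives a packet in the current slot is
  independent of what it has received so far. With U the number of slots in which it cannot decode
  and theta its reception rate, summing over the slots gives Wald's identity E[N] = theta * E[U],
  without any stopping-time theory; and U is at most the service time.

  Given the number j of receptions, the received headers are j independent uniform vectors. Since
  the expected number of slots spent with exactly j receptions is 1 / theta, E[N] is the sum over j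
  of the probability that j uniform headers do not have full rank, which no longer depends on theta,
  hence not on the destination. If E[U] is infinite for some destination, the service rate is 0;
  this covers reception rate 0.
*)
theory Submission
  imports Defs
begin

section \<open>Division in \<open>ennreal\<close>, countability of headers, monotonicity of full
  rank\<close>

lemma divide_left_mono_ennreal: "b \<le> c \<Longrightarrow> a / c \<le> a / b" for a b c :: ennreal
  including ennreal.lifting
  unfolding divide_ennreal_def by (intro mult_left_mono) (transfer, simp_all add: ereal_inverse_antimono)

text \<open>With the instance for \<open>bit\<close>, this makes lists of headers countable, so that
  \<open>measurable_received\<close> can fix the value of the shorter list in its induction
  step.\<close>

instance Matrix.vec :: (countable) countable
proof (rule countable_classI[of "\<lambda>v. to_nat (list_of_vec v)"])
  fix v w :: "'a Matrix.vec"
  assume "to_nat (list_of_vec v) = to_nat (list_of_vec w)"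
  then show "v = w" by (metis from_nat_to_nat vec_list)
qed

instance bit :: countable
  by (rule countable_classI[of "\<lambda>b. if b = 0 then 0 else 1"]) (auto split: if_splits)

text \<open>A maximal independent set among the columns of the smaller family has K elements and
  stays independent in the larger one, while no independent set in dimension K has more. Passing to
  sets of columns disposes of order and repetitions.\<close>

lemma rank_eq_dim_mono:
  assumes r: "vec_space.rank K (mat_of_cols K xs :: 'a :: field mat) = K" and sub: "set xs \<subseteq> set ys"
  shows "vec_space.rank K (mat_of_cols K ys) = K"
proof -
  interpret vec_space "TYPE('a)" K .
  define A B where "A = set (cols (mat_of_cols K xs))" and "B = set (cols (mat_of_cols K ys))"
  \<comment> \<open>The vectors may have any dimension; \<open>mat_of_cols\<close> reads their
    entries with index below K, hence the map on the right.\<close>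
  have "cols (mat_of_cols K zs) = map (\<lambda>v. Matrix.vec K (vec_index v)) zs" for zs :: "'a Matrix.vec list"
    by (auto intro!: nth_equalityI simp: mat_of_cols_def)
  then have cols: "set (cols (mat_of_cols K zs)) = (\<lambda>v. Matrix.vec K (vec_index v)) ` set zs"
    for zs :: "'a Matrix.vec list"
    by simp
  have A: "A \<subseteq> B" "B \<subseteq> carrier_vec K" "finite B"
    using sub by (auto simp: A_def B_def cols)
  have maximal: "\<exists>U. maximal U (\<lambda>T. T \<subseteq> C \<and> lin_indpt T)" if "finite C" for C
    using maximal_exists_superset[of C "\<lambda>T. T \<subseteq> C \<and> lin_indpt T" "{}"] that
    by (auto simp: lin_dep_def)
  obtain U where U: "maximal U (\<lambda>T. T \<subseteq> A \<and> lin_indpt T)"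
    using maximal[of A] A finite_subset by blast
  obtain W where W: "maximal W (\<lambda>T. T \<subseteq> B \<and> lin_indpt T)"
    using maximal[of B] A by blast
  have "card U = K"
    using rank_card_indpt[of "mat_of_cols K xs" "length xs" U] U r by (simp add: A_def)
  then have "K \<le> rank (mat_of_cols K ys)"
    using rank_ge_card_indpt[of "mat_of_cols K ys" "length ys" U] U A by (auto simp: B_def maximal_def)
  moreover have "card W \<le> K"
    using li_le_dim(2)[OF fin_dim, of W] W A by (auto simp: maximal_def dim_is_n)
  then have "rank (mat_of_cols K ys) \<le> K"
    using rank_card_indpt[of "mat_of_cols K ys" "length ys" W] W by (simp add: B_def)
  ultimately show ?thesis by simp
qed

section \<open>Receptions, first decoding time and service time along a fixed sample path\<close>

lemma received_Suc:
  "received n m \<omega> (Suc t) = received n m \<omega> t @ (if rx (\<omega> t) (n, m) then [header (\<omega> t) n] else [])"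
  by (simp add: received_def)

text \<open>Splits off the first slot, where \<open>received_Suc\<close> splits off the last; this
  fits the decomposition of the sequence measure in \<open>nn_integral_received\<close>.\<close>

lemma received_case_nat:
  "received n m (case_nat s \<omega>) (Suc t) = (if rx s (n, m) then [header s n] else []) @ received n m \<omega> t"
proof -
  have "[0..<Suc t] = 0 # map Suc [0..<t]" by (metis map_Suc_upt upt_conv_Cons zero_less_Suc)
  then show ?thesis by (simp add: received_def filter_map comp_def)
qed

lemma received_cong:
  "(\<And>s. s < t \<Longrightarrow> \<omega> s = \<omega>' s) \<Longrightarrow> received n m \<omega> t = received n m \<omega>' t"
  by (induction t) (simp_all add: received_Suc, simp add: received_def)

lemma set_received_mono: "t \<le> t' \<Longrightarrow> set (received n m \<omega> t) \<subseteq> set (received n m \<omega> t')"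
  by (auto simp: received_def)

lemma decodable_mono: "decodable K n m \<omega> t \<Longrightarrow> t \<le> t' \<Longrightarrow> decodable K n m \<omega> t'"
  unfolding decodable_def using rank_eq_dim_mono set_received_mono by blast

lemma length_received_ge_of_decodable:
  assumes "decodable K n m \<omega> t"
  shows "K \<le> length (received n m \<omega> t)"
  using vec_space.rank_le_nc[of "mat_of_cols K (received n m \<omega> t)" K "length (received n m \<omega> t)"] assms
  by (simp add: decodable_def)

lemma packets_needed_ge: "enat K \<le> packets_needed K n m \<omega>"
  using LeastI_ex[of "decodable K n m \<omega>"] length_received_ge_of_decodable[of K n m \<omega>]
  by (simp add: packets_needed_def)

lemma length_received: "length (received n m \<omega> t) = (\<Sum>s<t. of_bool (rx (\<omega> s) (n, m)))"
  by (induction t) (simp_all add: received_Suc, simp add: received_def)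

lemma received_eqI:
  assumes "t \<le> t'" "length (received n m \<omega> t') \<le> length (received n m \<omega> t)"
  shows "received n m \<omega> t = received n m \<omega> t'"
proof -
  have "\<exists>ys. received n m \<omega> t' = received n m \<omega> t @ ys" if "t \<le> t'"
    using that by (induction rule: dec_induct) (auto simp: received_Suc)
  with assms show ?thesis by auto
qed

text \<open>Telescoping, kept as an inequality: \<open>a \<le> b + (a - b)\<close> survives
  truncated subtraction and infinite reception times.\<close>

lemma reception_time_le_sum_gap: "reception_time n m \<omega> N \<le> (\<Sum>i = 1..N. gap n m \<omega> i)"
proof (induction N)
  case 0
  show ?case by (auto simp: reception_time_def zero_enat_def)
next
  case (Suc N)
  have "a \<le> b + (a - b)" for a b :: enat
    by (cases a; cases b) auto
  then have "reception_time n m \<omega> (Suc N)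
    \<le> reception_time n m \<omega> N + gap n m \<omega> (Suc N)"
    by (simp add: gap_def)
  also have "\<dots> \<le> (\<Sum>i = 1..N. gap n m \<omega> i) + gap n m \<omega> (Suc N)"
    using Suc by (rule add_right_mono)
  finally show ?case by simp
qed

text \<open>This is the first decoding time, or \<infinity> if there is none; as a series of
  indicators it allows expectations to be taken slot by slot.\<close>

definition undecided_slots :: "nat \<Rightarrow> source \<Rightarrow> dest \<Rightarrow> (nat \<Rightarrow> slot) \<Rightarrow> ennreal" where
  "undecided_slots K n m \<omega> = (\<Sum>t. of_bool (\<not> decodable K n m \<omega> t))"

text \<open>Decodability is never lost, so the indicator cuts the series off at the first decoding
  time. The weight f is 1 for counting slots and the reception indicator for counting
  packets.\<close>

lemma suminf_undecodable:
  fixes f :: "nat \<Rightarrow> ennreal"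
  assumes "\<exists>t. decodable K n m \<omega> t"
  shows "(\<Sum>t. f t * of_bool (\<not> decodable K n m \<omega> t)) = (\<Sum>t<(LEAST t. decodable K n m \<omega> t). f t)"
proof -
  define \<tau> where "\<tau> = (LEAST t. decodable K n m \<omega> t)"
  have eq: "decodable K n m \<omega> t \<longleftrightarrow> \<tau> \<le> t" for t
    unfolding \<tau>_def using decodable_mono[OF LeastI_ex[OF assms]] Least_le[of "decodable K n m \<omega>"] by blast
  have "(\<Sum>t. f t * of_bool (\<not> decodable K n m \<omega> t)) = (\<Sum>t<\<tau>. f t * of_bool (\<not> decodable K n m \<omega> t))"
    by (rule suminf_finite) (auto simp: eq)
  also have "\<dots> = (\<Sum>t<\<tau>. f t)" by (simp add: eq)
  finally show ?thesis unfolding \<tau>_def .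
qed

lemma undecided_slots_le_service_time_at:
  "undecided_slots K n m \<omega> \<le> ennreal_of_enat (service_time_at K n m \<omega>)"
proof (cases "\<exists>t. decodable K n m \<omega> t")
  case True
  define \<tau> where "\<tau> = (LEAST t. decodable K n m \<omega> t)"
  have \<tau>: "decodable K n m \<omega> \<tau>" "\<And>t. decodable K n m \<omega> t \<Longrightarrow> \<tau> \<le> t"
    using True by (auto simp: \<tau>_def intro: LeastI Least_le)
  define N where "N = length (received n m \<omega> \<tau>)"
  \<comment> \<open>Were N packets already there before \<tau>, nothing would arrive in between; the
    two received lists would agree and decoding would be possible before \<tau>.\<close>
  have "\<tau> \<le> (LEAST t. N \<le> length (received n m \<omega> t))" (is "_ \<le> ?\<sigma>")
  proof (rule ccontr)
    assume "\<not> \<tau> \<le> ?\<sigma>"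
    moreover have "N \<le> length (received n m \<omega> ?\<sigma>)"
      by (rule LeastI[of _ \<tau>]) (simp add: N_def)
    ultimately have "received n m \<omega> ?\<sigma> = received n m \<omega> \<tau>"
      by (intro received_eqI) (auto simp: N_def)
    with \<tau>(1) have "decodable K n m \<omega> ?\<sigma>" by (simp add: decodable_def)
    with \<tau>(2) \<open>\<not> \<tau> \<le> ?\<sigma>\<close> show False by blast
  qed
  then have "enat \<tau> \<le> reception_time n m \<omega> N"
    by (auto simp: reception_time_def)
  also have "\<dots> \<le> service_time_at K n m \<omega>"
    using True reception_time_le_sum_gap by (simp add: service_time_at_def packets_needed_def \<tau>_def N_def)
  finally have "ennreal_of_enat (enat \<tau>) \<le> ennreal_of_enat (service_time_at K n m \<omega>)"
    by (simp only: ennreal_of_enat_le_iff)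
  then show ?thesis
    using suminf_undecodable[OF True, of "\<lambda>_. 1"] by (simp add: undecided_slots_def \<tau>_def)
next
  case False
  then show ?thesis by (simp add: service_time_at_def packets_needed_def)
qed

text \<open>The packet that completes the rank arrives in the slot just before the first decoding
  time. It is counted, since \<open>decodable K n m \<omega> t\<close> looks only at slots before t
  and is still false there.\<close>

lemma packets_needed_eq_suminf:
  assumes "\<exists>t. decodable K n m \<omega> t"
  shows "ennreal_of_enat (packets_needed K n m \<omega>)
    = (\<Sum>t. of_bool (rx (\<omega> t) (n, m)) * of_bool (\<not> decodable K n m \<omega> t))"
  unfolding suminf_undecodable[OF assms]
  using assms by (simp add: packets_needed_def length_received)

lemma undecided_slots_eq_top:
  assumes "\<nexists>t. decodable K n m \<omega> t"
  shows "undecided_slots K n m \<omega> = \<infinity>"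
proof -
  \<comment> \<open>The constant series is infinite because it is the counting measure of an
    infinite set.\<close>
  have "(\<Sum>t::nat. 1 :: ennreal) = emeasure (count_space (UNIV :: nat set)) UNIV"
    by (simp only: nn_integral_count_space_nat[symmetric] nn_integral_const mult_1 space_count_space)
  with assms show ?thesis by (simp add: undecided_slots_def)
qed

section \<open>Expectations over independent slots\<close>

lemma suminf_binomial_pmf:
  assumes \<theta>: "0 < \<theta>" "\<theta> \<le> 1"
  shows "(\<Sum>t. ennreal \<theta> * ennreal (pmf (binomial_pmf t \<theta>) j)) = 1"
proof -
  \<comment> \<open>A success right after \<open>k + j\<close> trials with j successes is success
    number \<open>j + 1\<close>, preceded by k failures in all. These probabilities form a negative
    binomial distribution, so they sum to 1.\<close>
  have shift: "\<theta> * pmf (binomial_pmf (k + j) \<theta>) j = pmf (neg_binomial_pmf (Suc j) \<theta>) k" for k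
    using \<theta> by (simp add: pmf_neg_binomial binomial_symmetric[of j "k + j"])
  have "(\<Sum>t. ennreal (\<theta> * pmf (binomial_pmf t \<theta>) j))
      = (\<Sum>k. ennreal (\<theta> * pmf (binomial_pmf (k + j) \<theta>) j))"
  proof -
    \<comment> \<open>Fewer than j trials cannot give j successes, so the series may start at
      j.\<close>
    have "(\<Sum>t<j. ennreal (\<theta> * pmf (binomial_pmf t \<theta>) j)) = 0"
      using \<theta> by (intro sum.neutral) (simp add: binomial_eq_0)
    with suminf_offset[of "\<lambda>t. ennreal (\<theta> * pmf (binomial_pmf t \<theta>) j)" j] show ?thesis
      by (simp only: summableI add_0_right)
  qed
  also have "\<dots> = (\<integral>\<^sup>+ k. pmf (neg_binomial_pmf (Suc j) \<theta>) k \<partial>count_space UNIV)"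
    by (simp add: shift nn_integral_count_space_nat)
  also have "\<dots> = 1"
    by (simp add: nn_integral_pmf)
  finally show ?thesis
    using \<theta> by (simp add: ennreal_mult)
qed

text \<open>Isolates one source-destination pair: a slot enters only through its reception bit and
  header, which are independent. A header is drawn in every slot, transmitted or not.\<close>

locale iid_slots =
  fixes Q :: "slot pmf" and n :: source and m :: dest and \<theta> :: real and H :: "bit Matrix.vec pmf"
  assumes law: "map_pmf (\<lambda>s. (rx s (n, m), header s n)) Q = pair_pmf (bernoulli_pmf \<theta>) H"
    and \<theta>: "0 \<le> \<theta>" "\<theta> \<le> 1"
begin

sublocale sequence_space "measure_pmf Q"
  by unfold_locales

lemma measurable_slot_compose: "space M = UNIV \<Longrightarrow> (\<lambda>\<omega>. f (\<omega> t)) \<in> S \<rightarrow>\<^sub>M M"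
  by (rule measurable_compose[OF measurable_component_singleton[of t UNIV]]) auto

lemma measurable_received [measurable]: "(\<lambda>\<omega>. received n m \<omega> t) \<in> S \<rightarrow>\<^sub>M count_space UNIV"
proof (induction t)
  case 0
  show ?case by (simp add: received_def)
next
  case (Suc t)
  show ?case
    unfolding received_Suc
    by (rule measurable_compose_countable[OF _ Suc]) (rule measurable_slot_compose, simp)
qed

definition received_pmf :: "nat \<Rightarrow> bit Matrix.vec list pmf" where
  "received_pmf t = binomial_pmf t \<theta> \<bind> (\<lambda>j. replicate_pmf j H)"

text \<open>Recursion on the first slot, the distributional counterpart of
  \<open>received_case_nat\<close>.\<close>

lemma received_pmf_Suc:
  "received_pmf (Suc t) =
     pair_pmf (bernoulli_pmf \<theta>) H \<bind> (\<lambda>(b, h). map_pmf ((@) (if b then [h] else [])) (received_pmf t))"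
proof -
  have "bernoulli_pmf \<theta> \<bind> (\<lambda>b. binomial_pmf t \<theta> \<bind> (\<lambda>k. replicate_pmf ((if b then 1 else 0) + k) H))
    = bernoulli_pmf \<theta> \<bind> (\<lambda>b. H \<bind> (\<lambda>h. map_pmf ((@) (if b then [h] else [])) (received_pmf t)))"
  proof (rule bind_pmf_cong[OF refl])
    fix b
    show "binomial_pmf t \<theta> \<bind> (\<lambda>k. replicate_pmf ((if b then 1 else 0) + k) H)
      = H \<bind> (\<lambda>h. map_pmf ((@) (if b then [h] else [])) (received_pmf t))"
      \<comment> \<open>If b holds, the draws of the header and of the remaining reception count are
        interchanged; otherwise the header is drawn and discarded.\<close>
      by (cases b)
        (simp_all add: received_pmf_def map_pmf_def bind_assoc_pmf bind_return_pmf bind_return_pmf'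
          bind_commute_pmf[of H])
  qed
  then show ?thesis
    using \<theta> by (simp add: received_pmf_def binomial_pmf_Suc pair_pmf_def bind_assoc_pmf bind_return_pmf)
qed

text \<open>After the first slot the sequence has the same law again. The induction needs arbitrary
  f, because the header from the first slot is prepended inside f.\<close>

lemma nn_integral_received:
  fixes f :: "bit Matrix.vec list \<Rightarrow> ennreal"
  shows "(\<integral>\<^sup>+ \<omega>. f (received n m \<omega> t) \<partial>S) = (\<integral>\<^sup>+ xs. f xs \<partial>received_pmf t)"
proof (induction t arbitrary: f)
  case 0
  show ?case
    using \<theta> by (simp add: received_def received_pmf_def binomial_pmf_0 bind_return_pmf P.emeasure_space_1)
next
  case (Suc t)
  let ?g = "\<lambda>(b, h). \<integral>\<^sup>+ xs. f ((if b then [h] else []) @ xs) \<partial>received_pmf t"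
  have meas: "(\<lambda>(s, \<omega>). case_nat s \<omega>) \<in> measure_pmf Q \<Otimes>\<^sub>M S \<rightarrow>\<^sub>M S"
    by measurable
  have "(\<integral>\<^sup>+ \<omega>. f (received n m \<omega> (Suc t)) \<partial>S)
      = (\<integral>\<^sup>+ \<omega>. f (received n m \<omega> (Suc t)) \<partial>distr (measure_pmf Q \<Otimes>\<^sub>M S) S (\<lambda>(s, \<omega>). case_nat s \<omega>))"
    by (simp only: PiM_iter)
  also have "\<dots> = (\<integral>\<^sup>+ x. f (received n m (case x of (s, \<omega>) \<Rightarrow> case_nat s \<omega>) (Suc t)) \<partial>(measure_pmf Q \<Otimes>\<^sub>M S))"
    by (rule nn_integral_distr[OF meas]) measurable
  also have "\<dots> = (\<integral>\<^sup>+ s. \<integral>\<^sup>+ \<omega>. f (received n m (case_nat s \<omega>) (Suc t)) \<partial>S \<partial>measure_pmf Q)"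
    using P.nn_integral_fst[OF measurable_compose[OF meas, of "\<lambda>\<omega>. f (received n m \<omega> (Suc t))"]]
    by simp
  also have "\<dots> = (\<integral>\<^sup>+ s. ?g (rx s (n, m), header s n) \<partial>measure_pmf Q)"
    by (simp only: received_case_nat Suc.IH[of "\<lambda>xs. f (_ @ xs)"] prod.case)
  also have "\<dots> = (\<integral>\<^sup>+ x. ?g x \<partial>map_pmf (\<lambda>s. (rx s (n, m), header s n)) Q)"
    by simp
  also have "\<dots> = (\<integral>\<^sup>+ xs. f xs \<partial>received_pmf (Suc t))"
    by (simp add: law received_pmf_Suc case_prod_beta)
  finally show ?case .
qed

lemma nn_integral_rx: "(\<integral>\<^sup>+ \<omega>. of_bool (rx (\<omega> t) (n, m)) \<partial>S) = ennreal \<theta>"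
proof -
  have "(\<integral>\<^sup>+ \<omega>. of_bool (rx (\<omega> t) (n, m)) \<partial>S)
      = (\<integral>\<^sup>+ s. of_bool (rx s (n, m)) \<partial>distr S (measure_pmf Q) (\<lambda>\<omega>. \<omega> t))"
    by (subst nn_integral_distr) auto
  also have "\<dots> = (\<integral>\<^sup>+ s. of_bool (rx s (n, m)) \<partial>measure_pmf Q)"
    by (simp add: PiM_component)
  also have "\<dots> = (\<integral>\<^sup>+ (b, h). of_bool b \<partial>map_pmf (\<lambda>s. (rx s (n, m), header s n)) Q)"
    by simp
  also have "\<dots> = ennreal \<theta>"
    using \<theta> by (simp add: law nn_integral_pair_pmf')
  finally show ?thesis .
qed

text \<open>The received list depends only on slots before t, so it is independent of slot
  t.\<close>

lemma nn_integral_rx_mult_received: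
  fixes f :: "bit Matrix.vec list \<Rightarrow> ennreal"
  shows "(\<integral>\<^sup>+ \<omega>. of_bool (rx (\<omega> t) (n, m)) * f (received n m \<omega> t) \<partial>S)
    = ennreal \<theta> * (\<integral>\<^sup>+ \<omega>. f (received n m \<omega> t) \<partial>S)"
proof -
  have meas_rx: "(\<lambda>\<omega>. of_bool (rx (\<omega> t) (n, m)) :: ennreal) \<in> borel_measurable S" for t
    by (rule measurable_slot_compose) simp
  have meas': "(\<lambda>\<omega>. of_bool (rx (\<omega> t) (n, m)) * f (received n m \<omega> t)) \<in> borel_measurable S"
    by (intro borel_measurable_times_ennreal meas_rx) measurable
  have meas: "(\<lambda>x. of_bool (rx (snd x 0) (n, m)) * f (received n m (fst x) t)) \<in> borel_measurable (S \<Otimes>\<^sub>M S)"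
    by (intro borel_measurable_times_ennreal measurable_compose[OF measurable_snd measurable_slot_compose]
        measurable_compose[OF measurable_fst measurable_compose[OF measurable_received]]) simp_all
  \<comment> \<open>\<open>comb_seq\<close> glues the first t slots of \<omega> to the sequence
    \<omega>'. Slot t becomes slot 0 of \<omega>', so the two factors depend on different
    independent sequences.\<close>
  have split: "received n m (comb_seq t \<omega> \<omega>') t = received n m \<omega> t" "comb_seq t \<omega> \<omega>' t = \<omega>' 0" for \<omega> \<omega>'
    by (auto intro: received_cong simp: comb_seq_def)
  have "(\<integral>\<^sup>+ \<omega>. of_bool (rx (\<omega> t) (n, m)) * f (received n m \<omega> t) \<partial>S)
    = (\<integral>\<^sup>+ \<omega>. of_bool (rx (\<omega> t) (n, m)) * f (received n m \<omega> t)
        \<partial>distr (S \<Otimes>\<^sub>M S) S (\<lambda>(\<omega>, \<omega>'). comb_seq t \<omega> \<omega>'))"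
    by (simp only: PiM_comb_seq)
  also have "\<dots> = (\<integral>\<^sup>+ x. (case x of (\<omega>, \<omega>') \<Rightarrow> of_bool (rx (\<omega>' 0) (n, m)) * f (received n m \<omega> t)) \<partial>(S \<Otimes>\<^sub>M S))"
    by (subst nn_integral_distr[OF measurable_comb_seq]) (auto simp: split meas' intro!: nn_integral_cong)
  also have "\<dots> = (\<integral>\<^sup>+ \<omega>. \<integral>\<^sup>+ \<omega>'. of_bool (rx (\<omega>' 0) (n, m)) * f (received n m \<omega> t) \<partial>S \<partial>S)"
    using P.nn_integral_fst[OF meas] by (simp add: case_prod_beta)
  also have "\<dots> = ennreal \<theta> * (\<integral>\<^sup>+ \<omega>. f (received n m \<omega> t) \<partial>S)"
    by (simp only: nn_integral_multc[OF meas_rx] nn_integral_rx) (rule nn_integral_cmult, measurable)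
  finally show ?thesis .
qed

text \<open>Condition on the number j of receptions and exchange the sums: the weight of j is
  \<theta> times the expected number of t with exactly j receptions, which is 1 by
  \<open>suminf_binomial_pmf\<close>.\<close>

lemma suminf_received:
  fixes f :: "bit Matrix.vec list \<Rightarrow> ennreal"
  assumes "0 < \<theta>"
  shows "ennreal \<theta> * (\<Sum>t. \<integral>\<^sup>+ \<omega>. f (received n m \<omega> t) \<partial>S) = (\<Sum>j. \<integral>\<^sup>+ xs. f xs \<partial>replicate_pmf j H)"
proof -
  let ?a = "\<lambda>j. \<integral>\<^sup>+ xs. f xs \<partial>replicate_pmf j H"
  have "ennreal \<theta> * (\<Sum>t. \<integral>\<^sup>+ \<omega>. f (received n m \<omega> t) \<partial>S)
    = (\<Sum>t. ennreal \<theta> * (\<integral>\<^sup>+ j. ennreal (pmf (binomial_pmf t \<theta>) j) * ?a j \<partial>count_space UNIV))"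
    by (simp add: ennreal_suminf_cmult nn_integral_received received_pmf_def nn_integral_measure_pmf[of "binomial_pmf _ _"])
  also have "\<dots> = (\<Sum>t. \<integral>\<^sup>+ j. ennreal \<theta> * ennreal (pmf (binomial_pmf t \<theta>) j) * ?a j \<partial>count_space UNIV)"
    by (simp add: nn_integral_cmult mult.assoc)
  also have "\<dots> = (\<integral>\<^sup>+ j. (\<Sum>t. ennreal \<theta> * ennreal (pmf (binomial_pmf t \<theta>) j) * ?a j) \<partial>count_space UNIV)"
    by (rule nn_integral_suminf[symmetric]) simp
  also have "\<dots> = (\<integral>\<^sup>+ j. (\<Sum>t. ennreal \<theta> * ennreal (pmf (binomial_pmf t \<theta>) j)) * ?a j \<partial>count_space UNIV)"
    by (simp only: ennreal_suminf_multc)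
  also have "\<dots> = (\<Sum>j. ?a j)"
    by (simp only: suminf_binomial_pmf[OF assms \<theta>(2)] mult_1 nn_integral_count_space_nat)
  finally show ?thesis .
qed

lemma nn_integral_undecided_slots:
  "(\<integral>\<^sup>+ \<omega>. undecided_slots K n m \<omega> \<partial>S) = (\<Sum>t. \<integral>\<^sup>+ \<omega>. of_bool (\<not> decodable K n m \<omega> t) \<partial>S)"
  unfolding undecided_slots_def decodable_def
  by (rule nn_integral_suminf) measurable

text \<open>Wald's identity term by term: undecodability at t is a property of the list received
  before slot t. The hypothesis excludes paths without decoding, where \<open>packets_needed\<close>
  is \<infinity> but the receptions may be finite in number.\<close>

lemma expected_packets_eq:
  assumes "AE \<omega> in S. \<exists>t. decodable K n m \<omega> t"
  shows "(\<integral>\<^sup>+ \<omega>. ennreal_of_enat (packets_needed K n m \<omega>) \<partial>S)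
    = ennreal \<theta> * (\<integral>\<^sup>+ \<omega>. undecided_slots K n m \<omega> \<partial>S)"
proof -
  have "(\<integral>\<^sup>+ \<omega>. ennreal_of_enat (packets_needed K n m \<omega>) \<partial>S)
      = (\<integral>\<^sup>+ \<omega>. (\<Sum>t. of_bool (rx (\<omega> t) (n, m)) * of_bool (\<not> decodable K n m \<omega> t)) \<partial>S)"
    by (intro nn_integral_cong_AE eventually_mono[OF assms] packets_needed_eq_suminf)
  also have "\<dots> = (\<Sum>t. \<integral>\<^sup>+ \<omega>. of_bool (rx (\<omega> t) (n, m)) * of_bool (\<not> decodable K n m \<omega> t) \<partial>S)"
    unfolding decodable_def
    by (intro nn_integral_suminf borel_measurable_times_ennreal measurable_slot_compose) (simp, measurable)
  also have "\<dots> = (\<Sum>t. ennreal \<theta> * (\<integral>\<^sup>+ \<omega>. of_bool (\<not> decodable K n m \<omega> t) \<partial>S))"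
    unfolding decodable_def
    using nn_integral_rx_mult_received[of _ "\<lambda>xs. of_bool (vec_space.rank K (mat_of_cols K xs) \<noteq> K)"] by simp
  also have "\<dots> = ennreal \<theta> * (\<integral>\<^sup>+ \<omega>. undecided_slots K n m \<omega> \<partial>S)"
    by (simp add: nn_integral_undecided_slots ennreal_suminf_cmult)
  finally show ?thesis .
qed

text \<open>The right-hand side involves only K and H, so destinations with positive reception rates
  and the same header law share this value.\<close>

lemma nn_integral_undecided_slots_eq:
  assumes "0 < \<theta>"
  shows "ennreal \<theta> * (\<integral>\<^sup>+ \<omega>. undecided_slots K n m \<omega> \<partial>S)
    = (\<Sum>j. \<integral>\<^sup>+ xs. of_bool (vec_space.rank K (mat_of_cols K xs) \<noteq> K) \<partial>replicate_pmf j H)"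
  unfolding nn_integral_undecided_slots decodable_def by (rule suminf_received[OF assms])

text \<open>A path without decoding has infinitely many undecided slots, so finite expectation alone
  forces decoding almost surely; no estimate of ranks of random matrices enters.\<close>

lemma AE_decodable:
  assumes "(\<integral>\<^sup>+ \<omega>. undecided_slots K n m \<omega> \<partial>S) \<noteq> \<infinity>"
  shows "AE \<omega> in S. \<exists>t. decodable K n m \<omega> t"
proof -
  have "undecided_slots K n m \<in> borel_measurable S"
    unfolding undecided_slots_def decodable_def by measurable
  then have "AE \<omega> in S. undecided_slots K n m \<omega> \<noteq> \<infinity>"
    using assms by (rule nn_integral_PInf_AE)
  then show ?thesis
    by (rule eventually_mono) (metis undecided_slots_eq_top)
qed

lemma expected_packets_ge:
  "of_nat K \<le> (\<integral>\<^sup>+ \<omega>. ennreal_of_enat (packets_needed K n m \<omega>) \<partial>S)"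
proof -
  have "of_nat K = (\<integral>\<^sup>+ \<omega>. ennreal_of_enat (enat K) \<partial>S)"
    by (simp add: P.emeasure_space_1)
  also have "\<dots> \<le> (\<integral>\<^sup>+ \<omega>. ennreal_of_enat (packets_needed K n m \<omega>) \<partial>S)"
    by (intro nn_integral_mono) (simp only: ennreal_of_enat_le_iff packets_needed_ge)
  finally show ?thesis .
qed

end

section \<open>Reduction of the two-source slot to source 1 and one destination\<close>

definition reception_rate ::
  "(source \<Rightarrow> real) \<Rightarrow> (source \<Rightarrow> dest \<Rightarrow> real) \<Rightarrow> (source \<Rightarrow> dest \<Rightarrow> real) \<Rightarrow> dest \<Rightarrow> real"
where
  "reception_rate p q_alone q_both d = p S1 * (1 - p S2) * q_alone S1 d + p S1 * p S2 * q_both S1 d"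

context
  fixes p :: "source \<Rightarrow> real" and q_alone q_both :: "source \<Rightarrow> dest \<Rightarrow> real"
  assumes p: "\<And>n. 0 \<le> p n \<and> p n \<le> 1"
    and q: "\<And>n d. 0 \<le> q_both n d \<and> q_both n d \<le> q_alone n d \<and> q_alone n d \<le> 1"
begin

lemma q_alone_nonneg: "0 \<le> q_alone n d"
  using q[of n d] by linarith

lemma reception_rate_nonneg: "0 \<le> reception_rate p q_alone q_both d"
  using p q q_alone_nonneg by (simp add: reception_rate_def)

lemma reception_rate_le_1: "reception_rate p q_alone q_both d \<le> 1"
proof -
  have "reception_rate p q_alone q_both d \<le> p S1 * (1 - p S2) * 1 + p S1 * p S2 * 1"
    unfolding reception_rate_def using p q order_trans[of "q_both S1 d" "q_alone S1 d" 1]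
    by (intro add_mono mult_left_mono) auto
  also have "\<dots> = p S1" by (simp add: algebra_simps)
  finally show ?thesis using p[of S1] by simp
qed

text \<open>Total probability over the two transmission decisions; nothing is received when source 1
  is silent, which leaves the two terms of the rate.\<close>

lemma bind_reception_prob:
  "Pi_pmf {S1, S2} False (\<lambda>n. bernoulli_pmf (p n))
      \<bind> (\<lambda>x. bernoulli_pmf (reception_prob q_alone q_both x (S1, d)))
    = bernoulli_pmf (reception_rate p q_alone q_both d)" (is "?lhs = _")
proof -
  have "?lhs = bernoulli_pmf (p S1) \<bind> (\<lambda>x1. bernoulli_pmf (p S2) \<bind>
      (\<lambda>x2. bernoulli_pmf (if \<not> x1 then 0 else if x2 then q_both S1 d else q_alone S1 d)))"
    by (simp add: Pi_pmf_insert' Pi_pmf_singleton map_pmf_def bind_assoc_pmf bind_return_pmf reception_prob_def)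
      (intro bind_pmf_cong refl, simp)
  moreover have "pmf \<dots> True = reception_rate p q_alone q_both d"
    using p q q_alone_nonneg order_trans[of "q_both S1 d" "q_alone S1 d" 1]
    by (simp add: pmf_bind reception_rate_def algebra_simps)
  ultimately have "pmf ?lhs True = pmf (bernoulli_pmf (reception_rate p q_alone q_both d)) True"
    using reception_rate_nonneg reception_rate_le_1 by simp
  \<comment> \<open>A distribution on \<open>bool\<close> is determined by its value at
    \<open>True\<close>.\<close>
  moreover have "pmf M False = 1 - pmf M True" for M :: "bool pmf"
    using sum_pmf_eq_1[OF finite subset_UNIV, of M] by (simp add: UNIV_bool)
  ultimately show ?thesis
    by (intro pmf_eqI) (metis (full_types))
qed

lemma slot_law:
  "map_pmf (\<lambda>s. (rx s (S1, d), header s S1)) (slot_pmf K p q_alone q_both)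
    = pair_pmf (bernoulli_pmf (reception_rate p q_alone q_both d)) (header_pmf K)"
proof -
  let ?X = "Pi_pmf {S1, S2} False (\<lambda>n. bernoulli_pmf (p n))"
  let ?A = "Pi_pmf {S1, S2} (0\<^sub>v K) (\<lambda>_. header_pmf K)"
  let ?R = "\<lambda>x. Pi_pmf ({S1, S2} \<times> {D1, D2}) False (\<lambda>c. bernoulli_pmf (reception_prob q_alone q_both x c))"
  have d: "(S1, d) \<in> {S1, S2} \<times> {D1, D2}"
    by (cases d) auto
  have "map_pmf (\<lambda>s. (rx s (S1, d), header s S1)) (slot_pmf K p q_alone q_both)
    = ?X \<bind> (\<lambda>x. map_pmf (\<lambda>a. a S1) ?A \<bind> (\<lambda>h. map_pmf (\<lambda>r. r (S1, d)) (?R x) \<bind> (\<lambda>b. return_pmf (b, h))))"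
    by (simp add: slot_pmf_def map_pmf_def bind_assoc_pmf bind_return_pmf)
  also have "\<dots> = ?X \<bind> (\<lambda>x. header_pmf K \<bind>
      (\<lambda>h. bernoulli_pmf (reception_prob q_alone q_both x (S1, d)) \<bind> (\<lambda>b. return_pmf (b, h))))"
    using d by (simp only: Pi_pmf_component finite.intros finite_cartesian_product if_True insert_iff simp_thms)
  \<comment> \<open>Exchanging the draws puts the reception bit next to x, so that
    \<open>bind_reception_prob\<close> can integrate out the transmissions.\<close>
  also have "\<dots> = ?X \<bind> (\<lambda>x. bernoulli_pmf (reception_prob q_alone q_both x (S1, d)) \<bind>
      (\<lambda>b. header_pmf K \<bind> (\<lambda>h. return_pmf (b, h))))"
    by (subst bind_commute_pmf) (rule refl)
  also have "\<dots> = pair_pmf (bernoulli_pmf (reception_rate p q_alone q_both d)) (header_pmf K)"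
    by (simp only: bind_assoc_pmf[symmetric] bind_reception_prob pair_pmf_def)
  finally show ?thesis .
qed

lemma iid_slots_slot_pmf:
  "iid_slots (slot_pmf K p q_alone q_both) S1 d (reception_rate p q_alone q_both d) (header_pmf K)"
  using slot_law reception_rate_nonneg reception_rate_le_1 by unfold_locales

end

section \<open>The two bounds on the backlogged service rate\<close>

theorem mainTheorem4:
  fixes K :: nat
    and p :: "source \<Rightarrow> real"
    and q_alone q_both :: "source \<Rightarrow> dest \<Rightarrow> real"
    and m :: dest
  assumes K: "K \<ge> 1"
    and p: "\<And>n. 0 \<le> p n \<and> p n \<le> 1"
    and q: "\<And>n m. 0 \<le> q_both n m \<and> q_both n m < q_alone n m \<and> q_alone n m \<le> 1"
  shows "backlogged_service_rate K p q_alone q_both S1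
           \<le> of_nat K / expected_packets_needed K p q_alone q_both S1 m
              * ennreal (MIN d\<in>{D1, D2}. p S1 * (1 - p S2) * q_alone S1 d + p S1 * p S2 * q_both S1 d)
       \<and> of_nat K / expected_packets_needed K p q_alone q_both S1 m
              * ennreal (MIN d\<in>{D1, D2}. p S1 * (1 - p S2) * q_alone S1 d + p S1 * p S2 * q_both S1 d)
           \<le> ennreal (MIN d\<in>{D1, D2}. p S1 * (1 - p S2) * q_alone S1 d + p S1 * p S2 * q_both S1 d)"
proof -
  define \<theta> where "\<theta> d = reception_rate p q_alone q_both d" for d
  define N where "N d = expected_packets_needed K p q_alone q_both S1 d" for d
  define U where "U d = (\<integral>\<^sup>+ \<omega>. undecided_slots K S1 d \<omega> \<partial>slots K p q_alone q_both)" for d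
  define T where "T = (\<integral>\<^sup>+ \<omega>. ennreal_of_enat (service_time K S1 \<omega>) \<partial>slots K p q_alone q_both)"
  let ?min = "Min (\<theta> ` {D1, D2})"
  have slots: "iid_slots (slot_pmf K p q_alone q_both) S1 d (\<theta> d) (header_pmf K)" for d
    unfolding \<theta>_def using p q by (intro iid_slots_slot_pmf) (auto intro: less_imp_le)
  have K_le_N: "of_nat K \<le> N d" for d
    using iid_slots.expected_packets_ge[OF slots] by (simp add: N_def expected_packets_needed_def slots_def)
  have "U d \<le> T" for d
    unfolding U_def T_def
  proof (rule nn_integral_mono)
    fix \<omega>
    have "service_time_at K S1 d \<omega> \<le> service_time K S1 \<omega>"
      by (cases d) (simp_all add: service_time_def)
    then show "undecided_slots K S1 d \<omega> \<le> ennreal_of_enat (service_time K S1 \<omega>)"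
      using undecided_slots_le_service_time_at order_trans ennreal_of_enat_le_iff by blast
  qed
  have "of_nat K / T \<le> of_nat K / N m * ennreal ?min"
  \<comment> \<open>If T is infinite, the left-hand side is 0. Otherwise \<open>U d \<le> T\<close>
    makes both destinations decode almost surely.\<close>
  proof (cases "T = \<infinity>")
    case False
    then have fin: "U d \<noteq> \<infinity>" for d
      using \<open>U d \<le> T\<close> by (auto simp: top_unique)
    have N_U: "N d = ennreal (\<theta> d) * U d" for d
      using iid_slots.expected_packets_eq[OF slots iid_slots.AE_decodable[OF slots]] fin
      by (simp add: N_def U_def expected_packets_needed_def slots_def)
    \<comment> \<open>The product N d of the two factors is at least K \<ge> 1, so neither
      vanishes.\<close>
    have pos: "0 < \<theta> d" "U d \<noteq> 0" for d
      using K K_le_N[of d] iid_slots.\<theta>(1)[OF slots, of d] by (auto simp: N_U less_le)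
    have N_eq: "N d = N m" for d
      using iid_slots.nn_integral_undecided_slots_eq[OF slots pos(1)]
      by (simp add: N_U U_def slots_def)
    \<comment> \<open>A destination with the smallest rate gives the bound: there K / U d equals K
      \<theta> d / N d, and N d equals N m.\<close>
    obtain d where d: "?min = \<theta> d"
      using Min_in[of "\<theta> ` {D1, D2}"] by auto
    obtain u where u: "U d = ennreal u" "0 < u"
      using fin[of d] pos(2)[of d] by (cases "U d") auto
    have "of_nat K / T \<le> of_nat K / U d"
      using \<open>U d \<le> T\<close> by (rule divide_left_mono_ennreal)
    also have "\<dots> = of_nat K / N d * ennreal (\<theta> d)"
      using pos(1)[of d] u
      by (simp add: N_U divide_ennreal ennreal_mult[symmetric] ennreal_of_nat_eq_real_of_nat)
    finally show ?thesis
      by (simp only: N_eq[of d] d)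
  qed simp
  \<comment> \<open>Rank K requires at least K receptions, so the first factor is at most 1.\<close>
  moreover have "of_nat K / N m * ennreal ?min \<le> 1 * ennreal ?min"
  proof (rule mult_right_mono)
    have "of_nat K / N m \<le> of_nat K / of_nat K"
      using K_le_N by (rule divide_left_mono_ennreal)
    also have "\<dots> \<le> 1"
      using K by (simp add: ennreal_of_nat_eq_real_of_nat divide_ennreal)
    finally show "of_nat K / N m \<le> 1" .
  qed simp
  ultimately show ?thesis
    by (simp add: backlogged_service_rate_def T_def N_def \<theta>_def reception_rate_def)
qed

end
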